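(* Let $V$ be a three-dimensional completely entangled subspace supported in $\mathbb{C}^4\otimes\mathbb{C}^4$, spanned by $|\Psi_1\rangle,|\Psi_2\rangle,|\Psi_3\rangle$. Then there exists $|x\rangle\in\mathbb{C}^4$ such that the $3\times 4$ matrix $B(x)$ has rank $3$.
   Context: A subspace $V$ of $\mathbb{C}^4\otimes\mathbb{C}^4$ is a completely entangled subspace (CES) if it contains no nonzero product vector $|e\rangle\otimes|f\rangle$. It is said to be supported in $\mathbb{C}^4\otimes\mathbb{C}^4$ if it is not contained in any subspace $V_1\otimes V_2$ with $V_1,V_2\subseteq\mathbb{C}^4$ subspaces of which at least one is proper. For $|x\rangle\in\mathbb{C}^4$, $B(x)$ is the $3\times4$ matrix, depending linearly on $|x\rangle$, defined by the requirement that the system $\langle\Psi_i|x,y\rangle=0$ $(i=1,2,3)$ for $|y\rangle\in\mathbb{C}^4$ reads $B(x)|y\rangle=0$. Explicitly, if $|\Psi_i\rangle=\sum_{k,l=0}^{3}a^{(i)}_{kl}|k\rangle|l\rangle$ and $|x\rangle=\sum_k x_k|k\rangle$, then $[B(x)]_{il}=\sum_{k=0}^{3}\overline{a^{(i)}_{kl}}\,x_k$. Its rank does not depend on the choice of the basis $|\Psi_i\rangle$ of $V$. *)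

theory Defs
  imports "HOL-Analysis.Analysis"
begin

text \<open>
  All linear algebra is complex-linear: subspaces, spans and dimensions in \<open>complex ^ 'n\<close> are
  the constants with prefix \<open>vec\<close> (the unprefixed ones are real-linear), and \<open>rank\<close> is defined
  through \<open>vec.dim\<close>. The space \<open>\<complex>\<^sup>m \<otimes> \<complex>\<^sup>n\<close> is \<open>complex ^ ('m \<times> 'n)\<close>; the component
  at \<open>(k, l)\<close> is the coefficient of \<open>|k\<rangle>|l\<rangle>\<close>.
\<close>

definition product_vector ::
    "complex ^ 'm \<Rightarrow> complex ^ 'n \<Rightarrow> complex ^ ('m::finite \<times> 'n::finite)"
  where "product_vector e f = (\<chi> p. e $ fst p * f $ snd p)"

definition tensor_subspace ::
    "(complex ^ 'm) set \<Rightarrow> (complex ^ 'n) set \<Rightarrow> (complex ^ ('m::finite \<times> 'n::finite)) set"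
  where "tensor_subspace V1 V2 = vec.span {product_vector e f | e f. e \<in> V1 \<and> f \<in> V2}"

definition completely_entangled_subspace :: "(complex ^ ('m::finite \<times> 'n::finite)) set \<Rightarrow> bool"
  where "completely_entangled_subspace V \<longleftrightarrow>
    vec.subspace V \<and>
    \<not> (\<exists>e f. product_vector e f \<noteq> 0 \<and> product_vector e f \<in> V)"

definition supported :: "(complex ^ ('m::finite \<times> 'n::finite)) set \<Rightarrow> bool"
  where "supported V \<longleftrightarrow>
    \<not> (\<exists>V1 V2. vec.subspace V1 \<and> vec.subspace V2 \<and> (V1 \<noteq> UNIV \<or> V2 \<noteq> UNIV) \<and>
              V \<subseteq> tensor_subspace V1 V2)"

text \<open>
  The Hermitian inner product, conjugate-linear in the first argument (the library's \<open>\<bullet>\<close> on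
  \<open>complex ^ 'n\<close> is its real part).
\<close>

definition braket :: "complex ^ 'n \<Rightarrow> complex ^ 'n \<Rightarrow> complex"
  where "braket u v = (\<Sum>i\<in>UNIV. cnj (u $ i) * v $ i)"

definition B_matrix ::
    "('r \<Rightarrow> complex ^ ('m::finite \<times> 'n::finite)) \<Rightarrow> complex ^ 'm \<Rightarrow> complex ^ 'n ^ 'r"
  where "B_matrix \<Psi> x = (\<chi> i l. \<Sum>k\<in>UNIV. cnj (\<Psi> i $ (k, l)) * x $ k)"

lemma B_matrix_mult_vec:
  "(B_matrix \<Psi> x *v y) $ i = braket (\<Psi> i) (product_vector x y)"
proof -
  have "(B_matrix \<Psi> x *v y) $ i
      = (\<Sum>l\<in>UNIV. \<Sum>k\<in>UNIV. cnj (\<Psi> i $ (k, l)) * (x $ k * y $ l))"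
    by (simp add: B_matrix_def matrix_vector_mult_def sum_distrib_right mult.assoc)
  also have "\<dots> = (\<Sum>k\<in>UNIV. \<Sum>l\<in>UNIV. cnj (\<Psi> i $ (k, l)) * (x $ k * y $ l))"
    by (rule sum.swap)
  also have "\<dots> = braket (\<Psi> i) (product_vector x y)"
    by (simp add: braket_def product_vector_def sum.cartesian_product split_def
        flip: UNIV_Times_UNIV)
  finally show ?thesis .
qed

lemma B_matrix_mult_vec_eq_0_iff:
  "B_matrix \<Psi> x *v y = 0 \<longleftrightarrow> (\<forall>i. braket (\<Psi> i) (product_vector x y) = 0)"
  by (simp add: vec_eq_iff B_matrix_mult_vec)

end

theory Submission
  imports Defs
begin

text \<open>
  The rows of \<open>B(x)\<close> are bilinear forms \<open>f, g, h\<close> in \<open>(x, y)\<close>, and a product form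
  \<open>r(x) s(y)\<close> among their combinations is a product vector in \<open>V\<close>. Suppose that
  \<open>B(x)\<close> always has rank at most 2. If all \<open>2 \<times> 2\<close> minors of two of the rows vanish, a
  combination of these rows is a product form. Otherwise normalize so that, at some point \<open>p\<close>,
  \<open>B(p) e\<close> and \<open>B(p) e'\<close> are the first two unit vectors and \<open>h(p, -) = 0\<close>, and expand
  the vanishing minor \<open>det (B(p + t x) e, B(p + t x) e', B(p + t x) k)\<close> in \<open>t\<close> for
  \<open>k\<close> in the kernel \<open>K\<close> of \<open>B(p)\<close>: first order gives \<open>h(x, k) = 0\<close>, second order
  \<open>f(x, k) h(x, e) + g(x, k) h(x, e') = 0\<close>. As \<open>h\<close> is not a product form, \<open>h(-, e)\<close>
  and \<open>h(-, e')\<close> are linearly independent, so by polarization \<open>f(-, k)\<close> and \<open>g(-, k)\<close>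
  are determined by the single number \<open>g(u, k)\<close>, where \<open>h(u, e) = 1\<close> and \<open>h(u, e') = 0\<close>.
  Since \<open>dim K = 2\<close>, some nonzero \<open>k\<close> in \<open>K\<close> has \<open>g(u, k) = 0\<close>; it is killed by every
  \<open>B(x)\<close>, so \<open>V\<close> is not supported.
\<close>

section \<open>Linear independence of indexed families, rank and kernels\<close>

lemma dim_range_eq_card_iff:
  fixes v :: "'r::finite \<Rightarrow> 'a::field ^ 'n"
  shows "vec.dim (range v) = CARD('r) \<longleftrightarrow> (\<forall>c. (\<Sum>i\<in>UNIV. c i *s v i) = 0 \<longrightarrow> (\<forall>i. c i = 0))"
proof
  assume dim: "vec.dim (range v) = CARD('r)"
  have "card (range v) = CARD('r)"
    using vec.dim_le_card'[of "range v"] card_image_le[of UNIV v] dim by simp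
  then have inj: "inj v"
    by (simp add: eq_card_imp_inj_on)
  have "vec.independent (range v)"
    by (rule vec.card_le_dim_spanning[of _ "range v"])
      (use dim \<open>card (range v) = _\<close> in \<open>auto intro: vec.span_base\<close>)
  then have ind: "\<And>u. (\<Sum>w\<in>range v. u w *s w) = 0 \<Longrightarrow> \<forall>w\<in>range v. u w = 0"
    by (simp add: vec.independent_explicit)
  show "\<forall>c. (\<Sum>i\<in>UNIV. c i *s v i) = 0 \<longrightarrow> (\<forall>i. c i = 0)"
  proof (intro allI impI)
    fix c i assume "(\<Sum>i\<in>UNIV. c i *s v i) = 0"
    then have "(\<Sum>w\<in>range v. c (inv v w) *s w) = 0"
      by (simp add: sum.reindex[OF inj] inj)
    from ind[OF this] show "c i = 0" by (simp add: inj)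
  qed
next
  assume *: "\<forall>c. (\<Sum>i\<in>UNIV. c i *s v i) = 0 \<longrightarrow> (\<forall>i. c i = 0)"
  have inj: "inj v"
  proof (rule injI, rule ccontr)
    fix i j assume eq: "v i = v j" and "i \<noteq> j"
    \<comment> \<open>A repeated vector already gives a nontrivial relation, with coefficients 1 and
      -1.\<close>
    let ?c = "\<lambda>k. if k = i then 1 else if k = j then - 1 else (0::'a)"
    have "(\<Sum>k\<in>UNIV. ?c k *s v k) = (\<Sum>k\<in>{i, j}. ?c k *s v k)"
      by (rule sum.mono_neutral_right) auto
    also have "\<dots> = 0" using eq \<open>i \<noteq> j\<close> by simp
    finally have "?c i = 0" using *[rule_format, of ?c i] by blast
    then show False by simp
  qed
  have "vec.independent (range v)"
    unfolding vec.independent_explicit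
  proof (intro conjI allI impI)
    fix u assume "(\<Sum>w\<in>range v. u w *s w) = 0"
    then have "(\<Sum>i\<in>UNIV. u (v i) *s v i) = 0"
      by (simp add: sum.reindex[OF inj])
    with *[rule_format, of "\<lambda>i. u (v i)"] show "\<forall>w\<in>range v. u w = 0" by blast
  qed simp
  then show "vec.dim (range v) = CARD('r)"
    by (simp add: vec.dim_eq_card_independent card_image inj)
qed

lemma rank_eq_card_iff:
  fixes A :: "'a::field ^ 'n ^ 'm"
  shows "rank A = CARD('m) \<longleftrightarrow> (\<forall>c. (\<Sum>i\<in>UNIV. c i *s row i A) = 0 \<longrightarrow> (\<forall>i. c i = 0))"
proof -
  have "rows A = range (\<lambda>i. row i A)" by (auto simp: rows_def)
  then show ?thesis by (simp add: row_rank_def_gen dim_range_eq_card_iff)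
qed

lemma exists_kernel_vector:
  fixes A :: "'a::field ^ 'n ^ 'm"
  assumes "CARD('m) < CARD('n)"
  shows "\<exists>y. y \<noteq> 0 \<and> A *v y = 0"
proof (rule ccontr)
  assume "\<nexists>y. y \<noteq> 0 \<and> A *v y = 0"
  then have "inj ((*v) A)"
    using vec.inj_iff_eq_0[of A] by auto
  then have "vec.dim (range ((*v) A)) = CARD('n)"
    by (subst vec.dim_image_eq) (auto simp: card_cart_basis)
  moreover have "vec.dim (range ((*v) A)) \<le> CARD('m)"
    using vec.dim_subset[OF subset_UNIV, of "range ((*v) A)"] by (simp add: card_cart_basis)
  ultimately show False using assms by simp
qed

section \<open>Complex bilinear forms\<close>

definition bilinear_form :: "(complex ^ 'm \<Rightarrow> complex ^ 'n \<Rightarrow> complex) \<Rightarrow> bool"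
  where "bilinear_form f \<longleftrightarrow>
    (\<forall>x x' y. f (x + x') y = f x y + f x' y) \<and> (\<forall>a x y. f (a *s x) y = a * f x y) \<and>
    (\<forall>x y y'. f x (y + y') = f x y + f x y') \<and> (\<forall>a x y. f x (a *s y) = a * f x y)"

lemma bilinear_formD:
  assumes "bilinear_form f"
  shows "f (x + x') y = f x y + f x' y" "f (a *s x) y = a * f x y"
    "f x (y + y') = f x y + f x y'" "f x (a *s y) = a * f x y"
    "f (x - x') y = f x y - f x' y" "f x (y - y') = f x y - f x y'"
proof -
  show lin: "f (x + x') y = f x y + f x' y" "f (a *s x) y = a * f x y"
    "f x (y + y') = f x y + f x y'" "f x (a *s y) = a * f x y" for x x' y y' a
    using assms by (auto simp: bilinear_form_def)
  show "f (x - x') y = f x y - f x' y"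
    using lin(1)[of "x - x'" x' y] by simp
  show "f x (y - y') = f x y - f x y'"
    using lin(3)[of x "y - y'" y'] by simp
qed

lemma bilinear_form_zero: "bilinear_form f \<Longrightarrow> f x 0 = 0"
  using bilinear_formD(4)[of f x 0 0] by simp

lemma bilinear_form_combination:
  assumes "bilinear_form f" "bilinear_form g"
  shows "bilinear_form (\<lambda>x y. a * f x y + b * g x y)"
  unfolding bilinear_form_def
  by (simp add: bilinear_formD[OF assms(1)] bilinear_formD[OF assms(2)] algebra_simps)

lemma bilinear_form_expansion:
  fixes f :: "complex ^ 'm \<Rightarrow> complex ^ 'n \<Rightarrow> complex"
  assumes "bilinear_form f"
  shows "(\<Sum>l\<in>UNIV. f x (axis l 1) * y $ l) = f x y"
proof -
  have "f x (\<Sum>l\<in>S. y $ l *s axis l 1) = (\<Sum>l\<in>S. f x (axis l 1) * y $ l)" if "finite S" for S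
    using that by induction (auto simp: bilinear_formD[OF assms] bilinear_form_zero[OF assms])
  from this[of UNIV] show ?thesis by (simp add: basis_expansion)
qed

text \<open>Three linear conditions on a space of dimension above 3. The first arguments may differ,
  which allows two conditions at \<open>p\<close> and a third one at another point.\<close>

lemma common_zero:
  fixes f g h :: "complex ^ 'm \<Rightarrow> complex ^ 'n \<Rightarrow> complex"
  assumes "bilinear_form f" "bilinear_form g" "bilinear_form h" and "CARD('n) > 3"
  shows "\<exists>y. y \<noteq> 0 \<and> f u y = 0 \<and> g v y = 0 \<and> h w y = 0"
proof -
  let ?F = "\<lambda>(i::3) y. if i = 1 then f u y else if i = 2 then g v y else h w y"
  let ?A = "(\<chi> i l. ?F i (axis l 1)) :: complex ^ 'n ^ 3"
  obtain y where "y \<noteq> 0" and y: "?A *v y = 0"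
    using exists_kernel_vector[of ?A] assms by auto
  have "(?A *v y) $ i = ?F i y" for i
    by (simp add: matrix_vector_mult_def bilinear_form_expansion assms(1-3))
  then have "?F i y = 0" for i by (simp add: y)
  from this[of 1] this[of 2] this[of 3] show ?thesis using \<open>y \<noteq> 0\<close> by auto
qed

section \<open>Three bilinear forms that are dependent at every point\<close>

definition dependent_rows ::
    "(complex ^ 'm \<Rightarrow> complex ^ 'n \<Rightarrow> complex) \<Rightarrow> (complex ^ 'm \<Rightarrow> complex ^ 'n \<Rightarrow> complex) \<Rightarrow>
     (complex ^ 'm \<Rightarrow> complex ^ 'n \<Rightarrow> complex) \<Rightarrow> bool"
  where "dependent_rows f g h \<longleftrightarrow>
    (\<forall>x. \<exists>a b c. (a \<noteq> 0 \<or> b \<noteq> 0 \<or> c \<noteq> 0) \<and> (\<forall>y. a * f x y + b * g x y + c * h x y = 0))"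

text \<open>The nonzero row \<open>(a, b, c)\<close> annihilates the matrix with columns at
  \<open>u\<close>, \<open>v\<close>, \<open>w\<close>; eliminating shows that each coefficient
  times the determinant is 0.\<close>

lemma dependent_rows_minor:
  assumes "dependent_rows f g h"
  shows "f x u * (g x v * h x w - g x w * h x v) - f x v * (g x u * h x w - g x w * h x u)
       + f x w * (g x u * h x v - g x v * h x u) = 0" (is "?D = 0")
proof -
  obtain a b c where abc: "a \<noteq> 0 \<or> b \<noteq> 0 \<or> c \<noteq> 0"
    and eq: "\<And>y. a * f x y + b * g x y + c * h x y = 0"
    using assms by (auto simp: dependent_rows_def) metis
  have "a * ?D = 0" "b * ?D = 0" "c * ?D = 0"
    using eq[of u] eq[of v] eq[of w] by algebra+
  with abc show ?thesis by auto
qed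

lemma dependent_rows_subtract:
  assumes "dependent_rows f g h"
  shows "dependent_rows f g (\<lambda>x y. 1 * h x y + (-1) * (\<alpha> * f x y + \<beta> * g x y))"
  unfolding dependent_rows_def
proof
  fix x
  obtain a b c where abc: "a \<noteq> 0 \<or> b \<noteq> 0 \<or> c \<noteq> 0"
    and eq: "\<And>y. a * f x y + b * g x y + c * h x y = 0"
    using assms by (auto simp: dependent_rows_def) metis
  show "\<exists>a b c. (a \<noteq> 0 \<or> b \<noteq> 0 \<or> c \<noteq> 0) \<and>
      (\<forall>y. a * f x y + b * g x y + c * (1 * h x y + (-1) * (\<alpha> * f x y + \<beta> * g x y)) = 0)"
    using abc eq
    \<comment> \<open>The shifts by \<open>c * \<alpha>\<close> and \<open>c * \<beta>\<close> undo
      the subtraction; for \<open>c = 0\<close> the coefficients are the old ones, so they stay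
      nontrivial.\<close>
    by (intro exI[of _ "a + c * \<alpha>"] exI[of _ "b + c * \<beta>"] exI[of _ c]) (auto simp: algebra_simps)
qed

lemma product_form_if_minors_zero:
  assumes bf: "bilinear_form f" and bg: "bilinear_form g"
    and minors: "\<And>x y z. f x y * g x z = f x z * g x y"
  shows "\<exists>a b r s. (a \<noteq> 0 \<or> b \<noteq> 0) \<and> (\<forall>x y. a * f x y + b * g x y = r x * s y)"
proof (cases "\<forall>x y. f x y = 0")
  case True
  then show ?thesis
    by (intro exI[of _ 1] exI[of _ 0] exI[of _ "\<lambda>_. 0"]) auto
next
  case False
  then obtain p e where pe: "f p e \<noteq> 0" by auto
  \<comment> \<open>This combination vanishes at \<open>(p, e)\<close>, and by the minors at
    \<open>p\<close> on all of \<open>(p, -)\<close>.\<close>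
  define h where "h = (\<lambda>x y. (- g p e) * f x y + f p e * g x y)"
  have bh: "bilinear_form h"
    unfolding h_def by (intro bilinear_form_combination bf bg)
  have hp: "h p y = 0" for y
    using minors[of p e y] by (simp add: h_def algebra_simps)
  have mh: "f x y * h x z = f x z * h x y" for x y z
    using minors[of x y z] unfolding h_def by algebra
  have "f p e * h x z = f p z * h x e" for x z
  proof -
    \<comment> \<open>Replacing \<open>x\<close> by \<open>p + x\<close> changes only the factors
      from \<open>f\<close>; subtracting the relation at \<open>x\<close> leaves \<open>h x\<close>
      proportional to the fixed functional \<open>f p\<close>.\<close>
    have "(f p e + f x e) * h x z = (f p z + f x z) * h x e"
      using mh[of "p + x" e z] by (simp add: bilinear_formD[OF bf] bilinear_formD[OF bh] hp)
    with mh[of x e z] show ?thesis by algebra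
  qed
  then have "h x z = h x e * (f p z / f p e)" for x z
    using pe by (simp add: field_simps)
  then have "\<forall>x y. (- g p e) * f x y + f p e * g x y = h x e * (f p y / f p e)"
    unfolding h_def by blast
  with pe show ?thesis
    by (intro exI[of _ "- g p e"] exI[of _ "f p e"] exI[of _ "\<lambda>x. h x e"]
        exI[of _ "\<lambda>z. f p z / f p e"])
      blast
qed

lemma common_kernel_normalized:
  fixes f g h :: "complex ^ 'm \<Rightarrow> complex ^ 'n \<Rightarrow> complex"
  assumes bf: "bilinear_form f" and bg: "bilinear_form g" and bh: "bilinear_form h"
    and n: "CARD('n) > 3"
    and dep: "dependent_rows f g h"
    and no_product: "\<nexists>r s. \<forall>x y. h x y = r x * s y"
    and e: "f p e = 1" "f p e' = 0" "g p e = 0" "g p e' = 1" "h p e = 0" "h p e' = 0"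
  shows "\<exists>k. k \<noteq> 0 \<and> (\<forall>x. f x k = 0 \<and> g x k = 0 \<and> h x k = 0)"
proof -
  note lin = bilinear_formD[OF bf] bilinear_formD[OF bg] bilinear_formD[OF bh]
  note minor = dependent_rows_minor[OF dep]
  have hp: "h p y = 0" for y
    using minor[of p e e' y] by (simp add: e)
  \<comment> \<open>There is no constant term, so three distinct nonzero values of \<open>t\<close>
    determine the coefficients.\<close>
  have cubic: "a = 0 \<and> b = 0" if "\<And>t. t * a + t ^ 2 * b + t ^ 3 * c = 0" for a b c :: complex
  proof -
    have "a + b + c = 0" "- a + b - c = 0" "2 * a + 4 * b + 8 * c = 0"
      using that[of 1] that[of "-1"] that[of 2] by simp_all
    then show ?thesis by algebra
  qed
  have order: "h x k = 0 \<and> f x k * h x e + g x k * h x e' = 0"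
    if k: "f p k = 0" "g p k = 0" for x k
  proof -
    \<comment> \<open>\<open>?b\<close> and \<open>?c\<close> are the coefficients of
      \<open>t ^ 2\<close> and \<open>t ^ 3\<close> in the minor at \<open>p + t *s x\<close>; once
      \<open>h x k = 0\<close>, only the last two terms of \<open>?b\<close> remain.\<close>
    let ?b = "f x e * h x k + g x e' * h x k - f x k * h x e - g x k * h x e'"
    let ?c = "f x e * (g x e' * h x k - g x k * h x e') - f x e' * (g x e * h x k - g x k * h x e)
      + f x k * (g x e * h x e' - g x e' * h x e)"
    have "t * h x k + t ^ 2 * ?b + t ^ 3 * ?c = 0" for t
      using minor[of "p + t *s x" e e' k]
      by (simp add: lin e k hp algebra_simps power2_eq_square power3_eq_cube)
    from cubic[OF this] show ?thesis by (auto simp: algebra_simps add_eq_0_iff)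
  qed
  have h_eq: "h x y = f p y * h x e + g p y * h x e'" for x y
  proof -
    \<comment> \<open>The component of \<open>y\<close> in the common kernel of \<open>f p\<close>
      and \<open>g p\<close>, along \<open>e\<close> and \<open>e'\<close>.\<close>
    let ?k = "y - f p y *s e - g p y *s e'"
    have "h x ?k = 0" using order[of ?k x] by (simp add: lin e)
    then show ?thesis by (simp add: lin algebra_simps)
  qed
  have "\<exists>x y. h x e * h y e' - h x e' * h y e \<noteq> 0"
  proof (rule ccontr)
    assume "\<not> ?thesis"
    then have par: "h x e * h y e' = h x e' * h y e" for x y by simp
    have "\<exists>r s. \<forall>x y. h x y = r x * s y"
    proof (cases "\<forall>x. h x e = 0")
      case True
      then have "h x y = h x e' * g p y" for x y
        using h_eq[of x y] by simp
      then show ?thesis by (intro exI[of _ "\<lambda>x. h x e'"] exI[of _ "g p"]) blast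
    next
      case False
      then obtain z where z: "h z e \<noteq> 0" by auto
      have "h x e' = h x e * (h z e' / h z e)" for x
        using z par[of x z] by (simp add: field_simps)
      then have "h x y = h x e * (f p y + g p y * (h z e' / h z e))" for x y
        by (metis h_eq distrib_left mult.commute mult.left_commute)
      then show ?thesis
        by (intro exI[of _ "\<lambda>x. h x e"] exI[of _ "\<lambda>y. f p y + g p y * (h z e' / h z e)"]) blast
    qed
    with no_product show False by contradiction
  qed
  then obtain a b where ab: "h a e * h b e' - h a e' * h b e \<noteq> 0" (is "?d \<noteq> 0") by auto
  \<comment> \<open>By Cramer's rule, \<open>u\<close> and \<open>v\<close> are dual to the
    functionals \<open>h(-, e)\<close> and \<open>h(-, e')\<close>.\<close>
  define u where "u = (h b e' / ?d) *s a - (h a e' / ?d) *s b"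
  define v where "v = (h a e / ?d) *s b - (h b e / ?d) *s a"
  have uv: "h u e = 1" "h u e' = 0" "h v e = 0" "h v e' = 1"
    using ab by (simp_all add: u_def v_def lin divide_simps)
  obtain k where k: "k \<noteq> 0" "f p k = 0" "g p k = 0" "g u k = 0"
    using common_zero[OF bf bg bg n] by metis
  \<comment> \<open>Polarization of the quadratic identity in \<open>order\<close>; setting
    \<open>y\<close> to \<open>u\<close> isolates \<open>f x k\<close>, and setting it to
    \<open>v\<close> then isolates \<open>g x k\<close>.\<close>
  have polar: "f x k * h y e + g x k * h y e' + f y k * h x e + g y k * h x e' = 0" for x y
  proof -
    have "(f x k + f y k) * (h x e + h y e) + (g x k + g y k) * (h x e' + h y e') = 0"
      using order[OF k(2,3), of "x + y"] by (simp add: lin)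
    with order[OF k(2,3), of x] order[OF k(2,3), of y] show ?thesis by algebra
  qed
  have fu: "f u k = 0" using order[OF k(2,3), of u] by (simp add: uv)
  have f0: "f x k = 0" for x using polar[of x u] by (simp add: uv fu k)
  have "g x k = 0" for x using polar[of x v] order[OF k(2,3), of v] by (simp add: uv f0)
  with f0 k(1) order[OF k(2,3)] show ?thesis by blast
qed

text \<open>Reduction to the normalized case: a nonzero minor allows a change of basis in the span
  of \<open>d\<close> and \<open>d'\<close>, after which a combination of \<open>f\<close> and
  \<open>g\<close> is subtracted from \<open>h\<close>. Hence product forms are excluded for all
  \<open>a\<close> and \<open>b\<close>.\<close>

lemma common_kernel:
  fixes f g h :: "complex ^ 'm \<Rightarrow> complex ^ 'n \<Rightarrow> complex"
  assumes bf: "bilinear_form f" and bg: "bilinear_form g" and bh: "bilinear_form h"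
    and n: "CARD('n) > 3"
    and dep: "dependent_rows f g h"
    and no_product: "\<And>a b r s. \<not> (\<forall>x y. a * f x y + b * g x y + h x y = r x * s y)"
    and minor: "f p d * g p d' \<noteq> f p d' * g p d"
  shows "\<exists>k. k \<noteq> 0 \<and> (\<forall>x. f x k = 0 \<and> g x k = 0 \<and> h x k = 0)"
proof -
  let ?m = "f p d * g p d' - f p d' * g p d"
  define e where "e = (g p d' / ?m) *s d - (g p d / ?m) *s d'"
  define e' where "e' = (f p d / ?m) *s d' - (f p d' / ?m) *s d"
  have fg: "f p e = 1" "f p e' = 0" "g p e = 0" "g p e' = 1"
    using minor
    by (simp_all add: e_def e'_def bilinear_formD[OF bf] bilinear_formD[OF bg] divide_simps)
  define h' where "h' = (\<lambda>x y. 1 * h x y + (-1) * (h p e * f x y + h p e' * g x y))"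
  have "\<exists>k. k \<noteq> 0 \<and> (\<forall>x. f x k = 0 \<and> g x k = 0 \<and> h' x k = 0)"
  proof (rule common_kernel_normalized[where p = p and e = e and e' = e', OF bf bg _ n])
    show "bilinear_form h'"
      unfolding h'_def by (intro bilinear_form_combination bf bg bh)
    show "dependent_rows f g h'"
      unfolding h'_def by (rule dependent_rows_subtract[OF dep])
    show "\<nexists>r s. \<forall>x y. h' x y = r x * s y"
      using no_product[of "- h p e" "- h p e'"] by (simp add: h'_def algebra_simps)
  qed (simp_all add: fg h'_def)
  then obtain k where "k \<noteq> 0" and k: "\<And>x. f x k = 0 \<and> g x k = 0 \<and> h' x k = 0"
    by blast
  moreover have "h x k = 0" for x
    using k[of x] by (auto simp: h'_def)
  ultimately show ?thesis by blast
qed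

section \<open>From the forms back to the subspace\<close>

lemma bilinear_form_B_matrix: "bilinear_form (\<lambda>x y. (B_matrix \<Psi> x *v y) $ i)"
  unfolding bilinear_form_def B_matrix_mult_vec braket_def product_vector_def
  by (simp add: algebra_simps sum.distrib sum_distrib_left)

text \<open>Evaluating at basis vectors reads off the coefficients. The conjugations arise because
  \<open>B_matrix\<close> is conjugate-linear in \<open>\<Psi>\<close>.\<close>

lemma product_form_imp_product_vector:
  assumes "\<And>x y. (\<Sum>i\<in>UNIV. c i * (B_matrix \<Psi> x *v y) $ i) = r x * s y"
  shows "(\<Sum>i\<in>UNIV. cnj (c i) *s \<Psi> i)
    = product_vector (\<chi> k. cnj (r (axis k 1))) (\<chi> l. cnj (s (axis l 1)))"
proof (simp add: vec_eq_iff product_vector_def, intro allI)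
  fix k l
  have "(B_matrix \<Psi> (axis k 1) *v axis l 1) $ i = cnj (\<Psi> i $ (k, l))" for i
    by (simp add: B_matrix_def matrix_vector_mult_def axis_def if_distrib cong: if_cong)
  with assms[of "axis k 1" "axis l 1"]
  have "(\<Sum>i\<in>UNIV. c i * cnj (\<Psi> i $ (k, l))) = r (axis k 1) * s (axis l 1)" by simp
  then have "cnj (\<Sum>i\<in>UNIV. c i * cnj (\<Psi> i $ (k, l))) = cnj (r (axis k 1) * s (axis l 1))" by simp
  then show "(\<Sum>i\<in>UNIV. cnj (c i) * \<Psi> i $ (k, l)) = cnj (r (axis k 1)) * cnj (s (axis l 1))"
    by simp
qed

text \<open>With \<open>x\<close> a basis vector, the hypothesis says that each slice of
  \<open>\<Psi> i\<close> in the second factor is orthogonal to \<open>y\<close>. So the span lies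
  in the tensor product of the full space with the hyperplane \<open>?W\<close> orthogonal to
  \<open>y\<close>.\<close>

lemma not_supported_if_common_kernel:
  assumes "y \<noteq> 0" and ker: "\<And>x. B_matrix \<Psi> x *v y = 0"
  shows "\<not> supported (vec.span (range \<Psi>))"
proof -
  let ?W = "{f. (\<Sum>l\<in>UNIV. cnj (y $ l) * f $ l) = 0}"
  have W: "vec.subspace ?W"
    unfolding vec.subspace_def
    by (auto simp: algebra_simps sum.distrib simp flip: sum_distrib_left)
  have "y \<notin> ?W"
  proof
    assume "y \<in> ?W"
    then have "complex_of_real (\<Sum>l\<in>UNIV. (cmod (y $ l))\<^sup>2) = 0"
      by (simp add: complex_norm_square mult.commute del: of_real_power)
    then have "(\<Sum>l\<in>UNIV. (cmod (y $ l))\<^sup>2) = 0" by (simp only: of_real_eq_0_iff)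
    then have "\<forall>l. y $ l = 0" by (subst (asm) sum_nonneg_eq_0_iff) auto
    with \<open>y \<noteq> 0\<close> show False by (simp add: vec_eq_iff)
  qed
  then have proper: "?W \<noteq> UNIV" by blast
  have "\<Psi> i \<in> tensor_subspace UNIV ?W" for i
  proof -
    have "(\<chi> l. \<Psi> i $ (k, l)) \<in> ?W" for k
    proof -
      have "(B_matrix \<Psi> (axis k 1) *v y) $ i = (\<Sum>l\<in>UNIV. cnj (\<Psi> i $ (k, l)) * y $ l)"
        by (simp add: B_matrix_def matrix_vector_mult_def axis_def if_distrib cong: if_cong)
      then have "cnj (\<Sum>l\<in>UNIV. cnj (\<Psi> i $ (k, l)) * y $ l) = 0" by (simp add: ker)
      then show ?thesis by (simp add: mult.commute)
    qed
    then have "(\<Sum>k\<in>UNIV. product_vector (axis k 1) (\<chi> l. \<Psi> i $ (k, l))) \<in> tensor_subspace UNIV ?W"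
      unfolding tensor_subspace_def by (intro vec.span_sum vec.span_base) blast
    also have "(\<Sum>k\<in>UNIV. product_vector (axis k 1) (\<chi> l. \<Psi> i $ (k, l))) = \<Psi> i"
      by (simp add: vec_eq_iff product_vector_def axis_def if_distrib[of "\<lambda>c. c * z" for z] cong: if_cong)
    finally show ?thesis .
  qed
  then have "vec.span (range \<Psi>) \<subseteq> tensor_subspace UNIV ?W"
    unfolding tensor_subspace_def by (intro vec.span_minimal) auto
  then show ?thesis
    unfolding supported_def using W proper vec.subspace_UNIV by blast
qed

section \<open>Contradiction from rank below 3 at every point\<close>

theorem lemma1:
  fixes V :: "(complex ^ (4 \<times> 4)) set"
    and \<Psi> :: "3 \<Rightarrow> complex ^ (4 \<times> 4)"
  assumes "completely_entangled_subspace V"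
    and "vec.dim V = 3"
    and "supported V"
    and "V = vec.span (range \<Psi>)"
  shows "\<exists>x. rank (B_matrix \<Psi> x) = 3"
proof (rule ccontr)
  assume low_rank: "\<nexists>x. rank (B_matrix \<Psi> x) = 3"
  define F where "F = (\<lambda>i x y. (B_matrix \<Psi> x *v y) $ i)"
  have bil: "bilinear_form (F i)" for i
    unfolding F_def by (rule bilinear_form_B_matrix)
  have independent: "\<forall>i. c i = 0" if "(\<Sum>i\<in>UNIV. c i *s \<Psi> i) = 0" for c
    using dim_range_eq_card_iff[of \<Psi>] assms(2,4) that by simp
  have no_product: "\<not> (\<forall>x y. (\<Sum>i\<in>UNIV. c i * F i x y) = r x * s y)" if "c j \<noteq> 0" for c j r s
  proof
    assume "\<forall>x y. (\<Sum>i\<in>UNIV. c i * F i x y) = r x * s y"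
    then obtain e f where ef: "(\<Sum>i\<in>UNIV. cnj (c i) *s \<Psi> i) = product_vector e f"
      using product_form_imp_product_vector[of c \<Psi> r s] unfolding F_def by blast
    have "(\<Sum>i\<in>UNIV. cnj (c i) *s \<Psi> i) \<in> V"
      unfolding assms(4) by (intro vec.span_sum vec.span_scale vec.span_base) simp
    \<comment> \<open>Complete entanglement makes the product vector zero, which independence of the
      \<open>\<Psi> i\<close> forbids since \<open>cnj (c j)\<close> is nonzero.\<close>
    with ef assms(1) have "product_vector e f = 0"
      by (auto simp: completely_entangled_subspace_def)
    with ef independent[of "\<lambda>i. cnj (c i)"] that show False by simp
  qed
  have dep: "\<exists>c. (\<exists>i. c i \<noteq> 0) \<and> (\<forall>y. (\<Sum>i\<in>UNIV. c i * F i x y) = 0)" for x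
  proof -
    obtain c where c: "(\<Sum>i\<in>UNIV. c i *s row i (B_matrix \<Psi> x)) = 0" "\<exists>i. c i \<noteq> 0"
      using low_rank rank_eq_card_iff[of "B_matrix \<Psi> x"] by auto
    have "(\<Sum>i\<in>UNIV. c i * F i x y)
        = (\<Sum>l\<in>UNIV. (\<Sum>i\<in>UNIV. c i *s row i (B_matrix \<Psi> x)) $ l * y $ l)" for y
      unfolding F_def
      by (simp add: matrix_vector_mult_def row_def sum_distrib_left sum_distrib_right mult.assoc)
        (rule sum.swap)
    with c show ?thesis by auto
  qed
  have sum_distinct: "(\<Sum>n\<in>UNIV. t n) = t i + t j + t k" if "distinct [i, j, k]"
    for t :: "3 \<Rightarrow> complex" and i j k
  proof -
    have "UNIV = {i, j, k}"
      by (rule card_subset_eq[symmetric]) (use that in auto)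
    then have "sum t UNIV = sum t {i, j, k}" by simp
    with that show ?thesis by (simp add: add.assoc)
  qed
  \<comment> \<open>A nonzero minor of two rows would give a common kernel vector of all
    \<open>B_matrix \<Psi> x\<close>, against \<open>supported V\<close>.\<close>
  have minors: "F i x d * F j x d' = F i x d' * F j x d" if "distinct [i, j, k]" for i j k x d d'
  proof (rule ccontr)
    assume nz: "F i x d * F j x d' \<noteq> F i x d' * F j x d"
    have "dependent_rows (F i) (F j) (F k)"
      unfolding dependent_rows_def
    proof
      fix x
      obtain c n where c: "c n \<noteq> 0" "\<And>y. (\<Sum>i\<in>UNIV. c i * F i x y) = 0"
        using dep[of x] by blast
      have "n \<in> {i, j, k}"
        using card_subset_eq[of UNIV "{i, j, k}"] that by auto
      with c show "\<exists>a b c. (a \<noteq> 0 \<or> b \<noteq> 0 \<or> c \<noteq> 0) \<and>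
          (\<forall>y. a * F i x y + b * F j x y + c * F k x y = 0)"
        by (intro exI[of _ "c i"] exI[of _ "c j"] exI[of _ "c k"])
          (auto simp: sum_distinct[OF that])
    qed
    moreover have "\<not> (\<forall>x y. a * F i x y + b * F j x y + F k x y = r x * s y)" for a b r s
      \<comment> \<open>The coefficient 1 at \<open>k\<close> keeps the combination nontrivial for
        all \<open>a\<close> and \<open>b\<close>.\<close>
      using no_product[of "\<lambda>n. if n = i then a else if n = j then b else 1" k r s] that
      by (auto simp: sum_distinct[OF that])
    ultimately obtain y where y: "y \<noteq> 0" "\<And>x. F i x y = 0 \<and> F j x y = 0 \<and> F k x y = 0"
      using common_kernel[OF bil bil bil _ _ _ nz] by force
    have "B_matrix \<Psi> x *v y = 0" for x
    proof -
      have "F n x y = 0" for n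
        using card_subset_eq[of UNIV "{i, j, k}"] that y(2)[of x] by auto
      then show ?thesis by (simp add: vec_eq_iff F_def)
    qed
    from not_supported_if_common_kernel[OF y(1) this] assms(3,4) show False by simp
  qed
  \<comment> \<open>With all minors of rows 1 and 2 zero, a nontrivial combination of them is a
    product form.\<close>
  have d: "distinct [1, 2, 3::3]" by simp
  obtain a b r s where ab: "a \<noteq> 0 \<or> b \<noteq> 0" "\<forall>x y. a * F 1 x y + b * F 2 x y = r x * s y"
    using product_form_if_minors_zero[OF bil bil minors[OF d]] by blast
  let ?c = "\<lambda>n::3. if n = 1 then a else if n = 2 then b else 0"
  have "\<forall>x y. (\<Sum>i\<in>UNIV. ?c i * F i x y) = r x * s y"
    using ab(2) by (simp add: sum_3)
  moreover have "?c 1 \<noteq> 0 \<or> ?c 2 \<noteq> 0" using ab(1) by simp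
  ultimately show False using no_product[of ?c] by blast
qed

end
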